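(* Let $n\ge 5$ and let $B=(c,d)\in\{(1,2),(2,1),(n-1,n-2),(n-2,n-1)\}$. If $A\in\mathcal{G}(n)\setminus\{(0,0),(n,n)\}$, then $f_B(A)\le f(d,c)$.
   Context: For $n\in\mathbb{N}$, $\mathcal{G}(n)=\{(x,y)\in\mathbb{Z}^2: 0\le x\le n,\ 0\le y\le n\}$, and $\mathcal{P}_n$ is the set of lattice paths from $(0,0)$ to $(n,n)$ using only unit east steps $(1,0)$ and unit north steps $(0,1)$. For $A\in\mathcal{G}(n)$, $f(A)$ denotes the number of paths in $\mathcal{P}_n$ passing through $A$. For $A,B\in\mathcal{G}(n)$ with $B\notin\{(0,0),(n,n)\}$, $f_B(A)$ denotes the number of paths $p\in\mathcal{P}_n$ that pass through $A$ and do not pass through $B$ (so $f_B(B)=0$). *)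

theory Defs
  imports Main
begin

definition grid :: "nat \<Rightarrow> (int \<times> int) set" where
  "grid n = {(x, y). 0 \<le> x \<and> x \<le> int n \<and> 0 \<le> y \<and> y \<le> int n}"

definition unit_step :: "int \<times> int \<Rightarrow> int \<times> int \<Rightarrow> bool" where
  "unit_step P Q \<longleftrightarrow>
     Q = (fst P + 1, snd P) \<or> Q = (fst P, snd P + 1)"

(* A lattice path is represented by the list of the lattice points it visits, endpoints included;
   "p passes through A" is then A \<in> set p. *)
definition lattice_paths :: "nat \<Rightarrow> (int \<times> int) list set" where
  "lattice_paths n =
     {p. p \<noteq> [] \<and> hd p = (0, 0) \<and> last p = (int n, int n) \<and> successively unit_step p}"

definition paths_through :: "nat \<Rightarrow> int \<times> int \<Rightarrow> nat" where
  "paths_through n A = card {p \<in> lattice_paths n. A \<in> set p}"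

definition paths_through_avoiding :: "nat \<Rightarrow> int \<times> int \<Rightarrow> int \<times> int \<Rightarrow> nat" where
  "paths_through_avoiding n B A = card {p \<in> lattice_paths n. A \<in> set p \<and> B \<notin> set p}"

(* The sets counted above are finite, so card is a genuine count. *)
lemma successively_unit_step_last:
  assumes "successively unit_step p" "p \<noteq> []"
  shows "fst (last p) + snd (last p) = fst (hd p) + snd (hd p) + int (length p) - 1
    \<and> (\<forall>P\<in>set p. fst (hd p) \<le> fst P \<and> fst P \<le> fst (last p) \<and> snd (hd p) \<le> snd P \<and> snd P \<le> snd (last p))"
  using assms
proof (induction p)
  case (Cons P p)
  show ?case
  proof (cases "p = []")
    case False
    have s: "unit_step P (hd p)" "successively unit_step p"
      using Cons.prems False by (simp_all add: successively_Cons)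
    have h: "hd p \<in> set p" using False by simp
    show ?thesis
    proof (intro conjI ballI)
      note IH = Cons.IH[OF s(2) False]
      have hd_step: "fst P \<le> fst (hd p)" "snd P \<le> snd (hd p)"
        "fst (hd p) + snd (hd p) = fst P + snd P + 1"
        using s(1) by (auto simp: unit_step_def)
      show "fst (last (P # p)) + snd (last (P # p))
          = fst (hd (P # p)) + snd (hd (P # p)) + int (length (P # p)) - 1"
        using IH hd_step False by simp
      fix Q assume "Q \<in> set (P # p)"
      then consider "Q = P" | "Q \<in> set p" by auto
      then have Q: "fst P \<le> fst Q \<and> snd P \<le> snd Q \<and> fst Q \<le> fst (last p) \<and> snd Q \<le> snd (last p)"
      proof cases
        case 1
        then show ?thesis using IH h hd_step by (meson order_refl order_trans)
      next
        case 2
        then show ?thesis using IH hd_step by (meson order_trans)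
      qed
      show "fst (hd (P # p)) \<le> fst Q" "fst Q \<le> fst (last (P # p))"
        "snd (hd (P # p)) \<le> snd Q" "snd Q \<le> snd (last (P # p))"
        using Q False by simp_all
    qed
  qed simp
qed simp

lemma finite_lattice_paths: "finite (lattice_paths n)"
proof (rule finite_subset)
  show "lattice_paths n \<subseteq> {p. set p \<subseteq> {0..int n} \<times> {0..int n} \<and> length p = 2 * n + 1}"
  proof
    fix p assume "p \<in> lattice_paths n"
    then show "p \<in> {p. set p \<subseteq> {0..int n} \<times> {0..int n} \<and> length p = 2 * n + 1}"
      using successively_unit_step_last[of p] by (auto simp: lattice_paths_def)
  qed
  show "finite {p. set p \<subseteq> {0..int n} \<times> {0..int n} \<and> length p = 2 * n + 1}"
    by (rule finite_lists_length_eq) simp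
qed

end

theory Submission
  imports Defs "HOL.Binomial_Plus"
begin

text \<open>
  Swapping the coordinates and reversing the paths (a half turn of the square) are symmetries that
  carry each of the four choices of \<open>B\<close> to \<open>(1, 2)\<close>, so let \<open>B = (1, 2)\<close>.

  Write \<open>n = l + 3\<close> and \<open>M = (2 * l + 3) choose (l + 1)\<close>. The point \<open>(2, 1)\<close> is reached by 3 paths
  and \<open>M\<close> paths lead from it to \<open>(n, n)\<close>, so the bound to be proved is \<open>3 * M\<close>. A path that avoids \<open>(1, 2)\<close> meets the
  antidiagonal \<open>x + y = 3\<close> in \<open>(0, 3)\<close>, \<open>(2, 1)\<close> or \<open>(3, 0)\<close>, which are reached from the origin
  by 1, 3 and 1 paths.

  The main case is that \<open>A\<close> lies beyond this antidiagonal. From the three points the path crosses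
  rectangles with sides \<open>n\<close> and \<open>n - 3\<close>, or \<open>n - 2\<close> and \<open>n - 1\<close>, and the decisive fact
  (\<open>paths_through_interior_point_le\<close>) is that in a rectangle that is not a square no point
  other than the two end corners is on more paths than the better of the two neighbours of a
  corner. With \<open>a = (2 * l + 2) choose (l + 1)\<close> and \<open>b = (2 * l + 2) choose l\<close> the three
  counts of paths through \<open>A\<close> are thus at most \<open>b\<close>, \<open>a\<close> and \<open>b\<close>, and
  \<open>b + 3 * a + b \<le> 3 * (a + b) = 3 * M\<close> by Pascal's rule.

  The few points \<open>A\<close> on or before the antidiagonal are checked one by one; equality occurs
  for \<open>A = (2, 1)\<close>.

  The rectangle fact comes from Vandermonde's identity. Suppose that \<open>A\<close> is nearer to the first axis,
  say it is \<open>i\<close> steps east and \<open>j < i\<close> steps north of the corner. Among the paths to the point one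
  step before the opposite corner, those crossing the antidiagonal of \<open>A\<close> at \<open>A\<close> or at its
  neighbour closer to the diagonal already number at least as many as all the paths through
  \<open>A\<close>, since that neighbour is reached in at least as many ways. The other cases are symmetric; only
  a point on the diagonal of a square escapes them all.
\<close>

section \<open>Paths between two lattice points\<close>

text \<open>Arbitrary end points are allowed so that the pieces of a path cut at a point can be
  counted.\<close>

definition paths_between :: "int \<times> int \<Rightarrow> int \<times> int \<Rightarrow> (int \<times> int) list set" where
  "paths_between P Q = {p. p \<noteq> [] \<and> hd p = P \<and> last p = Q \<and> successively unit_step p}"

abbreviation level :: "int \<times> int \<Rightarrow> int" where
  "level P \<equiv> fst P + snd P"

lemma lattice_paths_eq: "lattice_paths n = paths_between (0, 0) (int n, int n)"
  by (simp add: lattice_paths_def paths_between_def)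

text \<open>Every step raises the level by one. Hence the end points determine the length of a path,
  and a path has at most one point on each level.\<close>

lemma paths_between_length:
  assumes "p \<in> paths_between P Q"
  shows "level Q = level P + int (length p) - 1"
  using assms successively_unit_step_last[of p] by (auto simp: paths_between_def)

lemma paths_between_in_box:
  assumes "p \<in> paths_between P Q" and "R \<in> set p"
  shows "fst P \<le> fst R" "fst R \<le> fst Q" "snd P \<le> snd R" "snd R \<le> snd Q"
  using assms successively_unit_step_last[of p] by (auto simp: paths_between_def)

lemma endpoints_in_paths_between:
  assumes "p \<in> paths_between P Q"
  shows "P \<in> set p" "Q \<in> set p"
  using assms by (auto simp: paths_between_def)

lemma finite_paths_between: "finite (paths_between P Q)"
proof (rule finite_subset)
  let ?box = "{fst P..fst Q} \<times> {snd P..snd Q}"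
  let ?len = "nat (level Q - level P + 1)"
  show "paths_between P Q \<subseteq> {p. set p \<subseteq> ?box \<and> length p = ?len}"
  proof
    fix p assume "p \<in> paths_between P Q"
    then show "p \<in> {p. set p \<subseteq> ?box \<and> length p = ?len}"
      using paths_between_length[of p P Q] paths_between_in_box[of p P Q] by fastforce
  qed
  show "finite {p. set p \<subseteq> ?box \<and> length p = ?len}"
    by (rule finite_lists_length_eq) simp
qed

lemma paths_between_self: "paths_between P P = {[P]}"
proof -
  have "p = [P]" if "p \<in> paths_between P P" for p
    using paths_between_length[OF that] that
    by (cases p) (auto simp: paths_between_def)
  then show ?thesis by (auto simp: paths_between_def)
qed

lemma paths_between_first_step:
  assumes "P \<noteq> Q"
  shows "paths_between P Q =
    (#) P ` (paths_between (fst P + 1, snd P) Q \<union> paths_between (fst P, snd P + 1) Q)"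
    (is "?L = ?R")
proof
  show "?L \<subseteq> ?R"
  proof
    fix p assume p: "p \<in> ?L"
    then obtain r where r: "p = P # r" by (cases p) (auto simp: paths_between_def)
    have "r \<noteq> []" using p r assms by (auto simp: paths_between_def)
    then have "r \<in> paths_between (fst P + 1, snd P) Q \<union> paths_between (fst P, snd P + 1) Q"
      using p r by (auto simp: paths_between_def successively_Cons unit_step_def)
    then show "p \<in> ?R" using r by blast
  qed
  show "?R \<subseteq> ?L"
    by (auto simp: paths_between_def successively_Cons unit_step_def)
qed

lemma paths_between_eq_empty:
  assumes "\<not> (fst P \<le> fst Q \<and> snd P \<le> snd Q)"
  shows "paths_between P Q = {}"
  using assms paths_between_in_box endpoints_in_paths_between by (metis all_not_in_conv)

text \<open>The recursion on the first step is Pascal's rule.\<close>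

lemma card_paths_between:
  "card (paths_between P Q) =
    (if fst P \<le> fst Q \<and> snd P \<le> snd Q
     then (nat (fst Q - fst P) + nat (snd Q - snd P)) choose nat (fst Q - fst P) else 0)"
proof (induction "nat (level Q - level P)" arbitrary: P rule: less_induct)
  case less
  consider "\<not> (fst P \<le> fst Q \<and> snd P \<le> snd Q)" | "P = Q"
    | "fst P \<le> fst Q" "snd P \<le> snd Q" "P \<noteq> Q" by blast
  then show ?case
  proof cases
    case 1
    then show ?thesis by (simp add: paths_between_eq_empty)
  next
    case 2
    then show ?thesis by (simp add: paths_between_self)
  next
    case 3
    let ?E = "(fst P + 1, snd P)" and ?N = "(fst P, snd P + 1)"
    define u v where "u = nat (fst Q - fst P)" and "v = nat (snd Q - snd P)"
    have lt: "level P < level Q"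
      using 3 by (metis add_le_less_mono add_less_le_mono order_le_imp_less_or_eq prod_eqI)
    have uv: "fst Q = fst P + int u" "snd Q = snd P + int v" using 3 by (auto simp: u_def v_def)
    have disj: "paths_between ?E Q \<inter> paths_between ?N Q = {}"
      by (auto simp: paths_between_def)
    have "card (paths_between P Q) = card (paths_between ?E Q) + card (paths_between ?N Q)"
      using disj by (simp add: paths_between_first_step[OF 3(3)] card_image card_Un_disjoint
        finite_paths_between)
    also have "card (paths_between ?E Q) = (if u = 0 then 0 else (u - 1 + v) choose (u - 1))"
      using less[of ?E] lt uv by (auto simp: nat_diff_distrib)
    also have "card (paths_between ?N Q) = (if v = 0 then 0 else (u + (v - 1)) choose u)"
      using less[of ?N] lt uv by (auto simp: nat_diff_distrib)
    also have "(if u = 0 then 0 else (u - 1 + v) choose (u - 1)) +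
        (if v = 0 then 0 else (u + (v - 1)) choose u) = (u + v) choose u"
      using lt uv by (cases u; cases v) auto
    finally show ?thesis using 3 by (simp add: u_def v_def)
  qed
qed

lemma card_paths_between_offset:
  assumes "fst Q = fst P + int u" "snd Q = snd P + int v"
  shows "card (paths_between P Q) = (u + v) choose u"
  using assms by (simp add: card_paths_between)

section \<open>Cutting a path at a point\<close>

lemma paths_between_through_eq:
  "{p \<in> paths_between P Q. X \<in> set p} =
    (\<lambda>(p, r). p @ tl r) ` (paths_between P X \<times> paths_between X Q)" (is "?L = ?R")
proof
  show "?L \<subseteq> ?R"
  proof
    fix p assume p: "p \<in> ?L"
    then obtain s t where "p = s @ X # t" by (auto dest: split_list)
    then have "p = (\<lambda>(p, r). p @ tl r) (s @ [X], X # t)" and "s @ [X] \<in> paths_between P X"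
      and "X # t \<in> paths_between X Q"
      using p by (auto simp: paths_between_def successively_append_iff successively_Cons hd_append
        split: if_splits)
    then show "p \<in> ?R" by blast
  qed
  show "?R \<subseteq> ?L"
  proof clarsimp
    fix p r assume p: "p \<in> paths_between P X" and "r \<in> paths_between X Q"
    then obtain t where "r = X # t" by (cases r) (auto simp: paths_between_def)
    with p \<open>r \<in> _\<close> show "p @ tl r \<in> paths_between P Q \<and> (X \<in> set p \<or> X \<in> set (tl r))"
      by (auto simp: paths_between_def successively_append_iff successively_Cons)
  qed
qed

text \<open>The cut is unique: all first parts have the same length, so equal concatenations have
  equal parts.\<close>

lemma card_paths_between_through:
  "card {p \<in> paths_between P Q. X \<in> set p} =
    card (paths_between P X) * card (paths_between X Q)"
proof -
  have "inj_on (\<lambda>(p, r). p @ tl r) (paths_between P X \<times> paths_between X Q)"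
  proof (rule inj_onI, clarsimp)
    fix p r p' r'
    assume p: "p \<in> paths_between P X" "p' \<in> paths_between P X"
      and r: "r \<in> paths_between X Q" "r' \<in> paths_between X Q"
      and eq: "p @ tl r = p' @ tl r'"
    have "length p = length p'" using p[THEN paths_between_length] by simp
    with eq have "p = p'" "tl r = tl r'" by auto
    then show "p = p' \<and> r = r'" using r by (auto simp: paths_between_def intro: list.expand)
  qed
  then show ?thesis
    by (simp add: paths_between_through_eq card_image card_cartesian_product)
qed

text \<open>Cutting at \<open>X\<close> and then cutting the second part at \<open>Y\<close>; the level condition
  ensures that \<open>Y\<close> is never met before \<open>X\<close>. The inequality is all that a union bound over
  crossing points asks for.\<close>

lemma card_paths_between_through_two:
  assumes "level X \<le> level Y"
  shows "card {p \<in> paths_between P Q. X \<in> set p \<and> Y \<in> set p}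
    \<le> card (paths_between P X) * (card (paths_between X Y) * card (paths_between Y Q))"
proof -
  let ?S = "paths_between P X \<times> {r \<in> paths_between X Q. Y \<in> set r}"
  have "{p \<in> paths_between P Q. X \<in> set p \<and> Y \<in> set p} \<subseteq> (\<lambda>(p, r). p @ tl r) ` ?S"
  proof
    fix p assume p: "p \<in> {p \<in> paths_between P Q. X \<in> set p \<and> Y \<in> set p}"
    then have "p \<in> {p \<in> paths_between P Q. X \<in> set p}" by simp
    then obtain s r where sr: "p = s @ tl r" "s \<in> paths_between P X" "r \<in> paths_between X Q"
      unfolding paths_between_through_eq by auto
    have "Y \<in> set r"
    proof (cases "Y \<in> set s")
      case True
      \<comment> \<open>A point of the first part on no lower level than \<open>X\<close> is \<open>X\<close> itself.\<close>
      then have "Y = X"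
        using paths_between_in_box[OF sr(2) True] assms by (simp add: prod_eq_iff)
      then show ?thesis using endpoints_in_paths_between[OF sr(3)] by simp
    next
      case False
      then have "Y \<in> set (tl r)" using p sr(1) by auto
      then show ?thesis by (cases r) auto
    qed
    then show "p \<in> (\<lambda>(p, r). p @ tl r) ` ?S" using sr by auto
  qed
  moreover have fin: "finite ?S" using finite_paths_between by simp
  ultimately have "card {p \<in> paths_between P Q. X \<in> set p \<and> Y \<in> set p} \<le> card ?S"
    by (meson surj_card_le)
  then show ?thesis by (simp add: card_cartesian_product card_paths_between_through)
qed

text \<open>Discrete continuity: the level grows by exactly one in each step.\<close>

lemma path_meets_level:
  assumes "p \<in> paths_between P Q" and "level P \<le> k" and "k \<le> level Q"
  shows "\<exists>X \<in> set p. level X = k"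
  using assms
proof (induction p arbitrary: P)
  case Nil
  then show ?case by (simp add: paths_between_def)
next
  case (Cons R p)
  have R: "R = P" using Cons.prems by (simp add: paths_between_def)
  show ?case
  proof (cases "level P = k")
    case False
    then have "P \<noteq> Q" using Cons.prems by auto
    then obtain P' where "p \<in> paths_between P' Q" "level P' = level P + 1"
      using Cons.prems(1) R paths_between_first_step[of P Q] by auto
    then have "\<exists>X \<in> set p. level X = k" using Cons.IH[of P'] Cons.prems False by simp
    then show ?thesis by simp
  qed (use R in simp)
qed

section \<open>Paths through an intermediate point\<close>

text \<open>Two adjacent terms of Vandermonde's identity: the paths that cross an antidiagonal at one
  of two neighbouring points.\<close>

lemma binomial_product_le_add:
  fixes m r k l :: nat
  shows "(m choose k) * (r choose Suc l) + (m choose Suc k) * (r choose l)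
    \<le> (m + r) choose (k + Suc l)"
proof -
  have "(m + r) choose (k + Suc l) =
      (\<Sum>t\<le>k + Suc l. (m choose t) * (r choose (k + Suc l - t)))"
    by (rule vandermonde[symmetric])
  also have "\<dots> \<ge> (\<Sum>t\<in>{k, Suc k}. (m choose t) * (r choose (k + Suc l - t)))"
    by (rule sum_mono2) auto
  finally show ?thesis by simp
qed

text \<open>Here \<open>A\<close> is \<open>i\<close> east and \<open>j\<close> north of the start, and the end is \<open>i'\<close> east and \<open>j'\<close> north
  of \<open>A\<close>. As \<open>j < i\<close>, the point \<open>(i - 1, j + 1)\<close> is at least as near to the middle of the
  antidiagonal of \<open>A\<close>, hence is reached by at least as many paths. Replacing \<open>A\<close> by it
  for the paths whose last step is north turns Pascal's rule for the second part into two terms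
  of a Vandermonde sum, which counts all paths to the point west of the end.\<close>

lemma through_le_if_right_of_diagonal:
  assumes "j < i" and "0 < i' + j'"
  shows "((i + j) choose j) * ((i' + j') choose j') \<le> (i + j + i' + j' - 1) choose (j + j')"
proof -
  obtain r where r: "i' + j' = Suc r" using assms(2) gr0_conv_Suc by blast
  show ?thesis
  proof (cases j')
    case 0
    have "(i + j) choose j \<le> (i + j + r) choose j" by (rule binomial_right_mono) simp
    then show ?thesis using 0 r by simp
  next
    case (Suc l)
    have "(i + j) choose j \<le> (i + j) choose Suc j"
    proof (cases "i = Suc j")
      case True
      \<comment> \<open>The row is odd and the two coefficients are its equal middle ones.\<close>
      then show ?thesis using binomial_symmetric[of j "i + j"] by simp
    next
      case False
      show ?thesis by (rule binomial_mono) (use assms False in auto)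
    qed
    then have "((i + j) choose j) * (Suc r choose Suc l)
        \<le> ((i + j) choose j) * (r choose Suc l) + ((i + j) choose Suc j) * (r choose l)"
      by (simp add: algebra_simps)
    also have "\<dots> \<le> (i + j + r) choose (j + Suc l)" by (rule binomial_product_le_add)
    finally show ?thesis using r Suc by (simp add: add.assoc)
  qed
qed

text \<open>If \<open>A\<close> is off the diagonal through the start, or off the diagonal through the end, the
  previous lemma applies after a reflection or with start and end exchanged. Otherwise
  \<open>i = j\<close> and \<open>i' = j'\<close>, and the rectangle is a square. For squares the bound can fail: the
  centre of the 2 by 2 square is on 4 of its 6 paths, a neighbour of a corner on 3.\<close>

lemma through_le_max:
  assumes "0 < i + j" "0 < i' + j'" and "i + i' \<noteq> j + j'"
  shows "((i + j) choose i) * ((i' + j') choose i')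
    \<le> max ((i + i' + (j + j') - 1) choose (i + i')) ((i + i' + (j + j') - 1) choose (j + j'))"
proof -
  have sym: "(i + j) choose i = (i + j) choose j" "(i' + j') choose i' = (i' + j') choose j'"
    using binomial_symmetric[of i "i + j"] binomial_symmetric[of i' "i' + j'"] by auto
  consider "j < i" | "i < j" | "j' < i'" | "i' < j'" using assms(3) by linarith
  then show ?thesis
  proof cases
    case 1
    then show ?thesis
      using through_le_if_right_of_diagonal[of j i i' j'] assms sym by (simp add: ac_simps)
  next
    case 2
    then show ?thesis
      using through_le_if_right_of_diagonal[of i j j' i'] assms by (simp add: ac_simps)
  next
    case 3
    then show ?thesis
      using through_le_if_right_of_diagonal[of j' i' i j] assms sym by (simp add: ac_simps)
  next
    case 4
    then show ?thesis
      using through_le_if_right_of_diagonal[of i' j' j i] assms by (simp add: ac_simps)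
  qed
qed

lemma paths_through_interior_point_le:
  assumes "fst Q = fst P + int u" "snd Q = snd P + int v" "u \<noteq> v" "A \<noteq> P" "A \<noteq> Q"
  shows "card (paths_between P A) * card (paths_between A Q)
    \<le> max ((u + v - 1) choose u) ((u + v - 1) choose v)"
proof (cases "fst P \<le> fst A \<and> snd P \<le> snd A \<and> fst A \<le> fst Q \<and> snd A \<le> snd Q")
  case True
  define i j where "i = nat (fst A - fst P)" and "j = nat (snd A - snd P)"
  define i' j' where "i' = nat (fst Q - fst A)" and "j' = nat (snd Q - snd A)"
  have uv: "u = i + i'" "v = j + j'"
    using True assms by (auto simp: i_def j_def i'_def j'_def)
  have "0 < i + j" "0 < i' + j'"
    using True assms by (auto simp: i_def j_def i'_def j'_def prod_eq_iff)
  then show ?thesis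
    using through_le_max[of i j i' j'] True assms(3)
    by (simp add: card_paths_between uv flip: i_def j_def i'_def j'_def)
next
  case False
  then have "card (paths_between P A) * card (paths_between A Q) = 0"
    by (auto simp: card_paths_between)
  then show ?thesis by (metis le0)
qed

section \<open>Avoiding the point (1, 2)\<close>

lemma avoiding_path_crosses:
  assumes "p \<in> paths_between (0, 0) Q" "3 \<le> level Q" "(1, 2) \<notin> set p"
  shows "(0, 3) \<in> set p \<or> (2, 1) \<in> set p \<or> (3, 0) \<in> set p"
proof -
  obtain X where X: "X \<in> set p" "level X = 3"
    using path_meets_level[OF assms(1), of 3] assms(2) by auto
  obtain x y where xy: "X = (x, y)" by (cases X)
  have "0 \<le> x" "0 \<le> y" using paths_between_in_box[OF assms(1) X(1)] xy by auto
  then have "x \<in> {0, 1, 2, 3}" "y = 3 - x" using X(2) xy by auto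
  then show ?thesis using X(1) xy assms(3) by auto
qed

text \<open>The union bound over the three possible crossing points. On or beyond level 3, the point
  \<open>A\<close> lies in the second part of the path, and before level 3 in the first part.\<close>

lemma card_through_avoiding_1_2_le:
  fixes l :: nat and A :: "int \<times> int"
  defines "Q \<equiv> (int l + 3, int l + 3)"
  assumes "0 \<le> fst A" "0 \<le> snd A" and "A \<noteq> (0, 0)" and "A \<noteq> Q"
  shows "card {p \<in> paths_between (0, 0) Q. A \<in> set p \<and> (1, 2) \<notin> set p}
    \<le> 3 * ((2 * l + 3) choose (l + 1))"
proof -
  let ?N = "\<lambda>P R. card (paths_between P R)"
  let ?F = "\<lambda>X. {p \<in> paths_between (0, 0) Q. A \<in> set p \<and> X \<in> set p}"
  define a b where "a = (2 * l + 2) choose (l + 1)" and "b = (2 * l + 2) choose l"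
  define M where "M = (2 * l + 3) choose (l + 1)"
  define M' where "M' = (2 * l + 3) choose l"
  have M: "M = a + b" by (simp add: M_def a_def b_def eval_nat_numeral)
  have M': "M' \<le> M" unfolding M_def M'_def by (rule binomial_mono) auto
  have N0: "?N (0, 0) (0, 3) = 1" "?N (0, 0) (2, 1) = 3" "?N (0, 0) (3, 0) = 1"
    by (simp_all add: card_paths_between eval_nat_numeral)
  have sym: "(2 * l + 3) choose (l + 3) = M'"
    using binomial_symmetric[of l "2 * l + 3"] by (simp add: M'_def)
  have len: "l + 3 + l = 2 * l + 3" "l + 1 + (l + 2) = 2 * l + 3" "l + (l + 3) = 2 * l + 3"
    by simp_all
  have NQ: "?N (0, 3) Q = M'" "?N (2, 1) Q = M" "?N (3, 0) Q = M'"
    using card_paths_between_offset[of Q "(0, 3)" "l + 3" l, unfolded len sym]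
      card_paths_between_offset[of Q "(2, 1)" "l + 1" "l + 2", unfolded len, folded M_def]
      card_paths_between_offset[of Q "(3, 0)" l "l + 3", unfolded len, folded M'_def]
    by (simp_all add: Q_def)
  show ?thesis
  proof (cases "A = (1, 2)")
    case True
    then have "{p \<in> paths_between (0, 0) Q. A \<in> set p \<and> (1, 2) \<notin> set p} = {}" by auto
    then show ?thesis by (simp only: card.empty le0)
  next
    case False
    have "{p \<in> paths_between (0, 0) Q. A \<in> set p \<and> (1, 2) \<notin> set p}
        \<subseteq> ?F (0, 3) \<union> ?F (2, 1) \<union> ?F (3, 0)"
      using avoiding_path_crosses[of _ Q] by (auto simp: Q_def)
    then have "card {p \<in> paths_between (0, 0) Q. A \<in> set p \<and> (1, 2) \<notin> set p}
        \<le> card (?F (0, 3) \<union> ?F (2, 1) \<union> ?F (3, 0))"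
      by (intro card_mono) (auto simp: finite_paths_between)
    also have "\<dots> \<le> card (?F (0, 3)) + card (?F (2, 1)) + card (?F (3, 0))"
      by (meson add_le_mono1 card_Un_le le_trans)
    also have "\<dots> \<le> 3 * M"
    proof -
      consider "level A \<le> 2" | "level A = 3" | "4 \<le> level A" by linarith
      then show ?thesis
      proof cases
        case 1
        have F: "card (?F X) \<le> ?N (0, 0) A * (?N A X * ?N X Q)" if "level X = 3" for X
          using card_paths_between_through_two[of A X "(0, 0)" Q] 1 that by simp
        obtain x y where xy: "A = (x, y)" by (cases A)
        have "A \<in> {(1, 0), (0, 1), (2, 0), (1, 1), (0, 2)}"
        proof -
          have "x \<in> {0, 1, 2}" "y \<in> {0, 1, 2}" using xy 1 assms(2,3) by auto
          then show ?thesis using xy 1 assms(4) by auto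
        qed
        \<comment> \<open>None of these points is on all 3 paths to \<open>(2, 1)\<close>, nor on both the path to \<open>(0, 3)\<close>
          and the one to \<open>(3, 0)\<close>.\<close>
        then have "?N (0, 0) A * (?N A (0, 3) * M') + ?N (0, 0) A * (?N A (2, 1) * M)
            + ?N (0, 0) A * (?N A (3, 0) * M') \<le> 2 * M + M'"
          using M' by (auto simp: card_paths_between eval_nat_numeral)
        then show ?thesis
          using F[of "(0, 3)"] F[of "(2, 1)"] F[of "(3, 0)"] M' by (simp add: NQ)
      next
        case 2
        have F: "card (?F X) \<le> ?N (0, 0) X * (?N X A * ?N A Q)" if "level X = 3" for X
          using card_paths_between_through_two[of X A "(0, 0)" Q] 2 that by (simp add: conj_commute)
        obtain x y where xy: "A = (x, y)" by (cases A)
        have "x \<in> {0, 1, 2, 3}" "y = 3 - x" using xy 2 assms(2,3) by auto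
        then have "A \<in> {(0, 3), (2, 1), (3, 0)}" using xy False by auto
        \<comment> \<open>Only the crossing point \<open>X = A\<close> contributes.\<close>
        then have "?N (0, 0) (0, 3) * (?N (0, 3) A * ?N A Q)
            + ?N (0, 0) (2, 1) * (?N (2, 1) A * ?N A Q)
            + ?N (0, 0) (3, 0) * (?N (3, 0) A * ?N A Q) \<le> 3 * M"
          unfolding N0 using M'
          by (elim insertE) (simp_all add: NQ paths_between_self paths_between_eq_empty)
        then show ?thesis
          using F[of "(0, 3)"] F[of "(2, 1)"] F[of "(3, 0)"] by simp
      next
        case 3
        have F: "card (?F X) \<le> ?N (0, 0) X * (?N X A * ?N A Q)" if "level X = 3" for X
          using card_paths_between_through_two[of X A "(0, 0)" Q] 3 that by (simp add: conj_commute)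
        have ne: "A \<noteq> (0, 3)" "A \<noteq> (2, 1)" "A \<noteq> (3, 0)" using 3 by auto
        have s: "(2 * l + 2) choose (l + 2) = b"
          using binomial_symmetric[of l "2 * l + 2"] by (simp add: b_def)
        have ab: "b \<le> a" unfolding a_def b_def by (rule binomial_mono) auto
        have s': "(2 * l + 2) choose (l + 3) \<le> b"
        proof (cases "l = 0")
          case False
          then show ?thesis unfolding s[symmetric] by (intro binomial_antimono) auto
        qed (simp add: binomial_eq_0)
        have len': "l + 1 + (l + 2) - 1 = 2 * l + 2" "l + 3 + l - 1 = 2 * l + 2"
          "l + (l + 3) - 1 = 2 * l + 2" by simp_all
        have "?N (2, 1) A * ?N A Q \<le> max ((l + 1 + (l + 2) - 1) choose (l + 1))
            ((l + 1 + (l + 2) - 1) choose (l + 2))"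
          by (rule paths_through_interior_point_le) (use ne assms(5) in \<open>auto simp: Q_def\<close>)
        then have A1: "?N (2, 1) A * ?N A Q \<le> a"
          unfolding len' s a_def[symmetric] using ab by simp
        have "?N (0, 3) A * ?N A Q \<le> max ((l + 3 + l - 1) choose (l + 3))
            ((l + 3 + l - 1) choose l)"
          by (rule paths_through_interior_point_le) (use ne assms(5) in \<open>auto simp: Q_def\<close>)
        then have A2: "?N (0, 3) A * ?N A Q \<le> b"
          unfolding len' b_def[symmetric] using s' by simp
        have "?N (3, 0) A * ?N A Q \<le> max ((l + (l + 3) - 1) choose l)
            ((l + (l + 3) - 1) choose (l + 3))"
          by (rule paths_through_interior_point_le) (use ne assms(5) in \<open>auto simp: Q_def\<close>)
        then have A3: "?N (3, 0) A * ?N A Q \<le> b"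
          unfolding len' b_def[symmetric] using s' by simp
        have "card (?F (0, 3)) + card (?F (2, 1)) + card (?F (3, 0)) \<le> b + 3 * a + b"
          using F[of "(0, 3)"] F[of "(2, 1)"] F[of "(3, 0)"] A1 A2 A3 by (simp add: N0)
        then show ?thesis by (simp add: M)
      qed
    qed
    finally show ?thesis by (simp add: M_def)
  qed
qed

lemma avoiding_1_2_le:
  assumes "3 \<le> n" and "A \<in> grid n - {(0, 0), (int n, int n)}"
  shows "paths_through_avoiding n (1, 2) A \<le> paths_through n (2, 1)"
proof -
  \<comment> \<open>The offset 3 makes both sides \<open>n\<close> and \<open>n - 3 = l\<close> of the rectangle from \<open>(0, 3)\<close> free
    of truncated subtraction.\<close>
  define l where "l = n - 3"
  have n: "int n = int l + 3" using assms(1) by (simp add: l_def)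
  have "paths_through n (2, 1) = 3 * ((2 * l + 3) choose (l + 1))"
    by (simp add: paths_through_def lattice_paths_eq card_paths_between_through)
      (simp add: card_paths_between n nat_add_distrib eval_nat_numeral)
  then show ?thesis
    using card_through_avoiding_1_2_le[of A l] assms(2)
    by (auto simp: paths_through_avoiding_def lattice_paths_eq n grid_def)
qed

section \<open>Symmetries of the square\<close>

text \<open>A symmetry acts on points by \<open>\<phi>\<close> and on paths by \<open>\<Phi>\<close>; the two are kept separate because
  \<open>\<Phi>\<close> may also reverse the order of the points.\<close>

lemma symmetry_invariance:
  fixes \<phi> :: "int \<times> int \<Rightarrow> int \<times> int" and \<Phi> :: "(int \<times> int) list \<Rightarrow> (int \<times> int) list"
  assumes inv: "\<And>P. \<phi> (\<phi> P) = P" "\<And>p. \<Phi> (\<Phi> p) = p"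
    and img: "\<And>p. set (\<Phi> p) = \<phi> ` set p"
    and closed: "\<And>p. p \<in> lattice_paths n \<Longrightarrow> \<Phi> p \<in> lattice_paths n"
  shows "paths_through n (\<phi> A) = paths_through n A"
    and "paths_through_avoiding n (\<phi> B) (\<phi> A) = paths_through_avoiding n B A"
proof -
  have mem: "P \<in> set (\<Phi> p) \<longleftrightarrow> \<phi> P \<in> set p" for P p
    unfolding img image_iff by (metis inv(1))
  have "bij_betw \<Phi> {p \<in> lattice_paths n. \<phi> A \<in> set p} {p \<in> lattice_paths n. A \<in> set p}"
    by (rule bij_betw_byWitness[where f' = \<Phi>]) (auto simp: inv mem closed)
  then show "paths_through n (\<phi> A) = paths_through n A"
    unfolding paths_through_def by (rule bij_betw_same_card)
  have "bij_betw \<Phi> {p \<in> lattice_paths n. \<phi> A \<in> set p \<and> \<phi> B \<notin> set p}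
      {p \<in> lattice_paths n. A \<in> set p \<and> B \<notin> set p}"
    by (rule bij_betw_byWitness[where f' = \<Phi>]) (auto simp: inv mem closed)
  then show "paths_through_avoiding n (\<phi> B) (\<phi> A) = paths_through_avoiding n B A"
    unfolding paths_through_avoiding_def by (rule bij_betw_same_card)
qed

lemma map_swap_lattice_paths:
  "p \<in> lattice_paths n \<Longrightarrow> map prod.swap p \<in> lattice_paths n"
  by (auto simp: lattice_paths_def hd_map last_map successively_map unit_step_def
      elim!: successively_mono)

definition antipode :: "nat \<Rightarrow> int \<times> int \<Rightarrow> int \<times> int" where
  "antipode n P = (int n - fst P, int n - snd P)"

lemma antipode_antipode [simp]: "antipode n (antipode n P) = P"
  by (simp add: antipode_def)

lemma rev_map_antipode_lattice_paths:
  "p \<in> lattice_paths n \<Longrightarrow> rev (map (antipode n) p) \<in> lattice_paths n"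
  by (auto simp: lattice_paths_def hd_map last_map hd_rev last_rev successively_map unit_step_def
      antipode_def elim!: successively_mono)

lemma swap_invariance:
  "paths_through n (prod.swap A) = paths_through n A"
  "paths_through_avoiding n (prod.swap B) (prod.swap A) = paths_through_avoiding n B A"
  by (rule symmetry_invariance[where \<Phi> = "map prod.swap"];
      simp add: comp_def map_swap_lattice_paths)+

lemma antipode_invariance:
  "paths_through n (antipode n A) = paths_through n A"
  "paths_through_avoiding n (antipode n B) (antipode n A) = paths_through_avoiding n B A"
  by (rule symmetry_invariance[where \<Phi> = "\<lambda>p. rev (map (antipode n) p)"];
      simp add: comp_def rev_map_antipode_lattice_paths flip: rev_map)+

lemma avoiding_2_1_le:
  assumes "3 \<le> n" and "A \<in> grid n - {(0, 0), (int n, int n)}"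
  shows "paths_through_avoiding n (2, 1) A \<le> paths_through n (1, 2)"
proof -
  have "prod.swap A \<in> grid n - {(0, 0), (int n, int n)}"
    using assms(2) by (auto simp: grid_def)
  then show ?thesis
    using avoiding_1_2_le[OF assms(1)] swap_invariance(1)[of n "(1, 2)"]
      swap_invariance(2)[of n "(2, 1)" A] by fastforce
qed

theorem theorem4p5:
  fixes n :: nat and c d :: int and A :: "int \<times> int"
  assumes "n \<ge> 5"
    and "(c, d) \<in> {(1, 2), (2, 1), (int n - 1, int n - 2), (int n - 2, int n - 1)}"
    and "A \<in> grid n - {(0, 0), (int n, int n)}"
  shows "paths_through_avoiding n (c, d) A \<le> paths_through n (d, c)"
proof -
  have n: "3 \<le> n" using assms(1) by simp
  \<comment> \<open>The half turn carries the two points \<open>B\<close> near the corner \<open>(n, n)\<close> to those near the origin.\<close>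
  have A': "antipode n A \<in> grid n - {(0, 0), (int n, int n)}"
    using assms(3) by (auto simp: grid_def antipode_def)
  note near = avoiding_1_2_le[OF n] avoiding_2_1_le[OF n]
  have "paths_through_avoiding n (antipode n (c, d)) (antipode n A)
      \<le> paths_through n (antipode n (d, c))"
    if "(c, d) \<in> {(int n - 1, int n - 2), (int n - 2, int n - 1)}"
    using that near[OF A'] by (auto simp: antipode_def[of n "(_, _)"])
  then show ?thesis
    using assms(2) near[OF assms(3)] antipode_invariance(1)[of n "(d, c)"]
      antipode_invariance(2)[of n "(c, d)" A] by auto
qed

end
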